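(* Fix $L,\sigma,b_0,\eta,D>0$. For every sequence $(r_T)_{T\ge 1}$ of positive reals with $r_T\to 0$, there exist a single convex $L$-smooth quadratic $f:\mathbb R\to\mathbb R$ with minimizer $x^\star=0$ (and $f^\star=f(x^\star)$), a single infinite-horizon stochastic gradient oracle for $f$, and a deterministic sequence of positive integers $T_n\to\infty$, such that both AdaGrad-Norm and AdaGrad, run on this instance with parameters $b_0,\eta$ and initialized at $x_1=x^\star=0$, satisfy the following. For all $t\ge 1$, the oracle is conditionally unbiased, $\mathbb E[g_t\mid\mathcal F_{t-1}]=f'(x_t)$, and its noise $\xi_t=g_t-f'(x_t)$ is sub-Gaussian, $$\mathbb E\big[\exp(\xi_t^2/\sigma^2)\,\big|\,\mathcal F_{t-1}\big]\le e;$$ moreover $|x_t-x^\star|\le D$ almost surely for all $t\ge1$, and $$\frac{\mathbb E[f(x_{T_n})-f^\star]}{r_{T_n}}\longrightarrow\infty\qquad(n\to\infty).$$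
   Context: A differentiable function $f:\mathbb R\to\mathbb R$ is $L$-smooth if $|f'(x)-f'(y)|\le L|x-y|$ for all $x,y$. Oracle and filtration: at each time $t\ge1$, queried at $x_t$, the oracle returns a random $g_t=f'(x_t)+\xi_t$. The oracle is allowed to be time- and history-dependent (the law of $g_t$ may depend on $t$ and on the past, and the oracle may use fresh randomness). The initialization $x_1$ is deterministic, $\mathcal F_0$ is trivial, and $\mathcal F_t=\sigma(g_1,\dots,g_t)$, so $x_t$ is $\mathcal F_{t-1}$-measurable. The instance (objective and oracle) is fixed and does not depend on the evaluation time $T_n$. Algorithms (dimension one): $b_t^2=b_0^2+\sum_{s=1}^t g_s^2$ with $b_t>0$, and $x_{t+1}=x_t-\eta\, g_t/b_t$ for $t\ge1$. This is the AdaGrad-Norm update in dimension one; coordinate-wise AdaGrad (with its single initial accumulator $b_{0,1}=b_0$) is the same recursion in dimension one, so the two algorithms have the same trajectory. *)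

theory Defs
  imports "HOL-Probability.Probability"
begin

definition L_smooth :: "real \<Rightarrow> (real \<Rightarrow> real) \<Rightarrow> bool" where
  "L_smooth L f \<longleftrightarrow>
     (\<forall>x. f differentiable (at x)) \<and> (\<forall>x y. \<bar>deriv f x - deriv f y\<bar> \<le> L * \<bar>x - y\<bar>)"

definition quadratic :: "(real \<Rightarrow> real) \<Rightarrow> bool" where
  "quadratic f \<longleftrightarrow> (\<exists>a b c. a \<noteq> 0 \<and> f = (\<lambda>x. a * x\<^sup>2 + b * x + c))"

text \<open>
  An update rule maps a time \<open>t\<close>, a sequence of gradients (of which only the entries
  \<open>1, \<dots>, t\<close> matter) and the iterate at time \<open>t\<close> to the iterate at time \<open>t + 1\<close>.
  The initial accumulator of coordinate-wise AdaGrad is a vector \<open>b0\<close>, with one entry per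
  coordinate; in dimension one it is a single number.
\<close>

type_synonym 'v update = "nat \<Rightarrow> (nat \<Rightarrow> 'v) \<Rightarrow> 'v \<Rightarrow> 'v"

definition adagrad_norm :: "real \<Rightarrow> real \<Rightarrow> 'v::euclidean_space update" where
  "adagrad_norm \<eta> b0 t g x = x - (\<eta> / sqrt (b0\<^sup>2 + (\<Sum>s=1..t. (norm (g s))\<^sup>2))) *\<^sub>R g t"

definition adagrad :: "real \<Rightarrow> 'v \<Rightarrow> 'v::euclidean_space update" where
  "adagrad \<eta> b0 t g x =
     x - (\<Sum>i\<in>Basis. (\<eta> / sqrt ((b0 \<bullet> i)\<^sup>2 + (\<Sum>s=1..t. (g s \<bullet> i)\<^sup>2)) * (g t \<bullet> i)) *\<^sub>R i)"

text \<open>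
  The answer at time \<open>t\<close> of an oracle \<open>G\<close> is \<open>G t (q, h, w)\<close>, where \<open>q\<close> holds the queries at
  times \<open>1, \<dots>, t\<close> (the last of which is the current one), \<open>h\<close> the answers at times
  \<open>1, \<dots>, t - 1\<close>, and \<open>w\<close> is fresh randomness with law \<open>S t\<close>, independent over time. So the law
  of the answer may depend on the time, on the current query and on the whole past.
\<close>

type_synonym 'v oracle_fun = "nat \<Rightarrow> (nat \<Rightarrow> 'v) \<times> (nat \<Rightarrow> 'v) \<times> real \<Rightarrow> 'v"

definition stochastic_oracle ::
    "(nat \<Rightarrow> real measure) \<Rightarrow> 'v::euclidean_space oracle_fun \<Rightarrow> bool" where
  "stochastic_oracle S G \<longleftrightarrow>
     (\<forall>t. prob_space (S t)) \<and>
     (\<forall>t\<ge>1. G t \<in> borel_measurable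
        ((\<Pi>\<^sub>M s\<in>{1..t}. borel) \<Otimes>\<^sub>M (\<Pi>\<^sub>M s\<in>{1..<t}. borel) \<Otimes>\<^sub>M S t))"

text \<open>
  \<open>iterate U x1 G t u\<close> and \<open>gradient U x1 G t u\<close> are the point \<open>x\<^sub>t\<close> and the oracle answer
  \<open>g\<^sub>t\<close>, for \<open>t \<ge> 1\<close>, when the update rule \<open>U\<close> is started at \<open>x1\<close> and run on the oracle \<open>G\<close>
  whose randomness at time \<open>t\<close> takes the value \<open>u t\<close>. The values at \<open>t = 0\<close> are irrelevant.
\<close>

lemma restrict_fundef_cong [fundef_cong]:
  "I = J \<Longrightarrow> (\<And>i. i \<in> J \<Longrightarrow> f i = g i) \<Longrightarrow> restrict f I = restrict g J"
  by (auto simp: restrict_def)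

function (sequential)
  iterate :: "'v update \<Rightarrow> 'v \<Rightarrow> 'v oracle_fun \<Rightarrow> nat \<Rightarrow> (nat \<Rightarrow> real) \<Rightarrow> 'v" and
  gradient :: "'v update \<Rightarrow> 'v \<Rightarrow> 'v oracle_fun \<Rightarrow> nat \<Rightarrow> (nat \<Rightarrow> real) \<Rightarrow> 'v"
where
  "iterate U x1 G t u =
     (if t \<le> 1 then x1
      else U (t - 1) (\<lambda>s\<in>{1..t-1}. gradient U x1 G s u) (iterate U x1 G (t - 1) u))"
| "gradient U x1 G t u =
     G t ((\<lambda>s\<in>{1..t}. iterate U x1 G s u), (\<lambda>s\<in>{1..<t}. gradient U x1 G s u), u t)"
  by pat_completeness auto

termination
  by (relation "Wellfounded.measure (case_sum (\<lambda>(U, x1, G, t, u). 2 * t) (\<lambda>(U, x1, G, t, u). 2 * t + 1))")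
     auto

declare iterate.simps [simp del] gradient.simps [simp del]

definition past :: "'a measure \<Rightarrow> (nat \<Rightarrow> 'a \<Rightarrow> real) \<Rightarrow> nat \<Rightarrow> 'a measure" where
  "past M g t = sigma (space M) {g s -` A \<inter> space M | s A. s \<in> {1..t} \<and> A \<in> sets borel}"

end

theory Submission
  imports Defs
begin

text \<open>
  The instance is \<open>f x = a / 2 * x\<^sup>2\<close> with \<open>a = min L (b0 / \<eta>)\<close>, and the oracle adds to the
  exact gradient a symmetric noise \<open>\<plusminus> c t\<close> whose sign is a fair coin. The amplitude \<open>c\<close> vanishes
  except at the times \<open>T n - 1\<close>, where it is \<open>C / 2 ^ Suc n\<close>; so each \<open>T n\<close> comes right after
  a kick, whose expected effect on \<open>f\<close> is of order \<open>1 / 4 ^ n\<close> no matter how late \<open>T n\<close> is. As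
  \<open>r\<close> tends to zero, the \<open>T n\<close> can be chosen so late that \<open>r (T n) < 1 / 8 ^ n\<close>, and the
  quotient grows at least like \<open>2 ^ n\<close>.

  What has to be shown is that a kick of size \<open>c t\<close> moves the iterate by at least a fixed
  multiple of \<open>c t\<close>, which means that the accumulator \<open>b t\<close> stays bounded. This holds because the
  total amplitude is at most \<open>b0 / 4\<close>: noiseless steps contract towards \<open>0\<close> (this is
  \<open>\<eta> * a \<le> b0\<close>), the distance that they travel is paid for by earlier kicks, and hence
  \<open>\<Sum>t. \<bar>g t\<bar> / b t\<close> is at most \<open>1 / 2\<close>, which only leaves room for \<open>b t \<le> 2 * b0\<close>
  (\<open>adagrad_summable_noise\<close>). The same bookkeeping gives \<open>\<bar>x t\<bar> \<le> \<eta> * C / b0\<close>.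

  All probabilistic facts come from one symmetry: reversing the coin at time \<open>t\<close> preserves the
  product measure and the past of \<open>t\<close>, but changes the sign of the noise. So the noise
  integrates to zero over every event of the past (\<open>gradient_unbiased\<close>), and since one of the two
  signs pushes the iterate away from the minimizer, averaging over the pair bounds the second
  moment of \<open>x (Suc t)\<close> from below (\<open>second_moment_after_kick\<close>).
\<close>

section \<open>AdaGrad with summable noise\<close>

text \<open>
  The drift \<open>a * \<bar>x t\<bar> / b t\<close> is what an exact gradient step takes off \<open>\<bar>x\<bar> / \<eta>\<close>, so
  \<open>P t = 1 - 2 / b0 * (\<Sum>s=1..t. c s) + \<bar>x (Suc t)\<bar> / \<eta>\<close> drops by at least \<open>\<bar>g t\<bar> / b t\<close> in
  step \<open>t\<close>. As \<open>b t - \<bar>g t\<bar> \<le> b (t - 1)\<close>, the product \<open>b t * P t\<close> never increases, and it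
  starts at \<open>b0\<close>.
\<close>

lemma adagrad_summable_noise:
  fixes a \<eta> b0 :: real and x g c :: "nat \<Rightarrow> real"
  defines "b \<equiv> \<lambda>t. sqrt (b0\<^sup>2 + (\<Sum>s=1..t. (g s)\<^sup>2))"
  assumes a: "a \<ge> 0" and \<eta>: "\<eta> > 0" and b0: "b0 > 0" and ab: "\<eta> * a \<le> b0"
    and x1: "x 1 = 0"
    and step: "\<And>t. t \<ge> 1 \<Longrightarrow> x (Suc t) = x t - \<eta> / b t * g t"
    and noise: "\<And>t. t \<ge> 1 \<Longrightarrow> \<bar>g t - a * x t\<bar> \<le> c t"
    and budget: "\<And>t. (\<Sum>s=1..t. c s) \<le> b0 / 4"
  shows "\<bar>x (Suc t)\<bar> \<le> \<eta> / b0 * (\<Sum>s=1..t. c s)" and "b t \<le> 2 * b0"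
proof -
  define P where "P t = 1 - 2 / b0 * (\<Sum>s=1..t. c s) + \<bar>x (Suc t)\<bar> / \<eta>" for t
  have b_ge: "b t \<ge> b0" for t
    unfolding b_def using b0 by (intro real_le_rsqrt) (simp add: sum_nonneg)
  have P_ge: "P t \<ge> 1 / 2" for t
  proof -
    have "2 / b0 * (\<Sum>s=1..t. c s) \<le> 2 / b0 * (b0 / 4)"
      using budget b0 by (intro mult_left_mono) auto
    also have "\<dots> = 1 / 2" using b0 by simp
    finally have "2 / b0 * (\<Sum>s=1..t. c s) \<le> 1 / 2" .
    moreover have "\<bar>x (Suc t)\<bar> / \<eta> \<ge> 0" using \<eta> by simp
    ultimately show ?thesis unfolding P_def by linarith
  qed
  have main: "\<bar>x (Suc t)\<bar> \<le> \<eta> / b0 * (\<Sum>s=1..t. c s) \<and> b t * P t \<le> b0" for t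
  proof (induction t)
    case 0
    show ?case using b0 x1 by (simp add: b_def P_def)
  next
    case (Suc t)
    define B X C s G where "B = b (Suc t)" and "X = \<bar>x (Suc t)\<bar>" and "C = c (Suc t)"
      and "s = (\<Sum>s=1..t. c s)" and "G = \<bar>g (Suc t)\<bar>"
    have B: "B \<ge> b0" "B > 0" using b_ge[of "Suc t"] b0 by (auto simp: B_def)
    have C: "C \<ge> 0" using noise[of "Suc t"] by (simp add: C_def)
    have X0: "X \<ge> 0" and G0: "G \<ge> 0" by (auto simp: X_def G_def)
    have sum: "(\<Sum>s=1..Suc t. c s) = s + C" by (simp add: s_def C_def)
    have contraction: "\<bar>1 - \<eta> * a / B\<bar> = 1 - \<eta> * a / B"
      using ab B by simp
    have "x (Suc (Suc t)) = (1 - \<eta> * a / B) * x (Suc t) - \<eta> / B * (g (Suc t) - a * x (Suc t))"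
      using step[of "Suc t"] by (simp add: B_def algebra_simps)
    then have "\<bar>x (Suc (Suc t))\<bar> \<le> (1 - \<eta> * a / B) * X + \<eta> / B * \<bar>g (Suc t) - a * x (Suc t)\<bar>"
      using \<eta> B contraction unfolding X_def
      by (metis abs_triangle_ineq4 abs_mult abs_of_pos divide_pos_pos)
    also have "\<dots> \<le> (1 - \<eta> * a / B) * X + \<eta> / B * C"
      using noise[of "Suc t"] \<eta> B by (simp add: C_def mult_left_mono divide_right_mono)
    finally have X': "\<bar>x (Suc (Suc t))\<bar> \<le> (1 - \<eta> * a / B) * X + \<eta> / B * C" .
    have G: "G \<le> a * X + C"
      using noise[of "Suc t"] a abs_triangle_ineq[of "g (Suc t) - a * x (Suc t)" "a * x (Suc t)"]
      by (simp add: G_def C_def X_def abs_mult)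
    have BG: "B \<le> b t + G"
    proof -
      have "B\<^sup>2 = (b t)\<^sup>2 + G\<^sup>2"
        by (simp add: B_def b_def G_def add_nonneg_nonneg sum_nonneg)
      also have "\<dots> \<le> (b t + G)\<^sup>2"
        using b_ge[of t] b0 G0 by (simp add: power2_sum)
      finally show ?thesis
        by (rule power2_le_imp_le) (use b_ge[of t] b0 G0 in simp)
    qed
    have "\<bar>x (Suc (Suc t))\<bar> \<le> X + \<eta> / b0 * C"
    proof -
      have "\<eta> * a / B * X \<ge> 0" using \<eta> a B X0 by simp
      moreover have "\<eta> / B * C \<le> \<eta> / b0 * C"
        using \<eta> B b0 C by (intro mult_right_mono divide_left_mono) auto
      ultimately show ?thesis using X' by (simp add: algebra_simps)
    qed
    then have 1: "\<bar>x (Suc (Suc t))\<bar> \<le> \<eta> / b0 * (s + C)"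
      using Suc.IH by (simp add: X_def s_def algebra_simps)
    have P1: "P t \<le> 1"
    proof -
      have "s \<ge> 0"
        unfolding s_def using noise by (intro sum_nonneg) (force intro: order_trans[OF abs_ge_zero])
      then have "0 \<le> s / b0" using b0 by simp
      moreover have "X / \<eta> \<le> s / b0"
        using Suc.IH \<eta> b0 by (simp add: X_def s_def field_simps)
      ultimately show ?thesis by (simp add: P_def X_def s_def)
    qed
    have "\<bar>x (Suc (Suc t))\<bar> / \<eta> \<le> ((1 - \<eta> * a / B) * X + \<eta> / B * C) / \<eta>"
      using X' \<eta> by (intro divide_right_mono) auto
    also have "\<dots> = X / \<eta> - a * X / B + C / B"
      using \<eta> B by (simp add: field_simps)
    finally have "P (Suc t) \<le> P t - 2 * C / b0 - a * X / B + C / B"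
      by (simp add: P_def s_def C_def X_def algebra_simps add_divide_distrib)
    moreover have "2 * C / b0 \<ge> 2 * C / B"
      using B b0 C by (intro divide_left_mono) auto
    ultimately have "P (Suc t) \<le> P t - (a * X + C) / B"
      by (simp add: add_divide_distrib)
    also have "\<dots> \<le> P t - G / B"
      using G B by (simp add: divide_right_mono)
    finally have "B * P (Suc t) \<le> B * (P t - G / B)"
      using B by (intro mult_left_mono) auto
    also have "\<dots> = B * P t - G" using B by (simp add: field_simps)
    also have "\<dots> \<le> (b t + G) * P t - G"
      using BG P_ge[of t] by (intro diff_right_mono mult_right_mono) auto
    also have "\<dots> \<le> b t * P t"
      using mult_left_mono[OF P1 G0] by (simp add: algebra_simps)
    finally have "B * P (Suc t) \<le> b0" using Suc.IH by linarith
    then show ?case using 1 sum by (simp add: B_def)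
  qed
  show "\<bar>x (Suc t)\<bar> \<le> \<eta> / b0 * (\<Sum>s=1..t. c s)" using main by blast
  have "b t * (1 / 2) \<le> b t * P t"
    using P_ge b_ge[of t] b0 by (intro mult_left_mono) auto
  then show "b t \<le> 2 * b0" using main[of t] by linarith
qed

text \<open>
  If the sign of \<open>\<xi>\<close> is opposite to that of \<open>x\<close>, the displacement \<open>- q * \<xi>\<close> points away from
  the minimizer, so its length adds to the distance \<open>(1 - q * a) * \<bar>x\<bar>\<close> left by the exact
  gradient step.
\<close>

lemma kick_away_from_minimizer:
  fixes a x \<xi> q :: real
  assumes "q \<ge> 0" "q * a \<le> 1" "\<xi> * x \<le> 0"
  shows "(x - q * (a * x + \<xi>))\<^sup>2 \<ge> (q * \<xi>)\<^sup>2"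
proof -
  define p where "p = 1 - q * a"
  have "(x - q * (a * x + \<xi>))\<^sup>2 = (p * x - q * \<xi>)\<^sup>2"
    by (simp add: p_def algebra_simps)
  also have "\<dots> = (p * x)\<^sup>2 + 2 * (p * q) * (- (\<xi> * x)) + (q * \<xi>)\<^sup>2"
    by (simp add: power2_diff algebra_simps)
  also have "\<dots> \<ge> (q * \<xi>)\<^sup>2"
  proof -
    have "0 \<le> 2 * (p * q) * (- (\<xi> * x))"
      using assms by (intro mult_nonneg_nonneg) (auto simp: p_def)
    then show ?thesis using zero_le_power2[of "p * x"] by linarith
  qed
  finally show ?thesis .
qed

section \<open>Sparse kick times\<close>

text \<open>The bound \<open>2\<close> makes \<open>T n - 1\<close> a time at which the oracle is queried.\<close>

lemma late_times:
  fixes r :: "nat \<Rightarrow> real" and \<epsilon> :: "nat \<Rightarrow> real"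
  assumes "r \<longlonglongrightarrow> 0" and "\<And>n. \<epsilon> n > 0"
  obtains T where "strict_mono T" "\<And>n. T n \<ge> 2" "\<And>n. r (T n) < \<epsilon> n"
proof -
  have ev: "eventually (\<lambda>t. r t < \<epsilon> n) sequentially" for n
    using order_tendstoD(2)[OF assms(1) assms(2)] .
  have "\<exists>T. \<forall>n. (T n \<ge> 2 \<and> r (T n) < \<epsilon> n) \<and> T n < T (Suc n)"
  proof (rule dependent_nat_choice)
    show "\<exists>y. 2 \<le> y \<and> r y < \<epsilon> 0"
      using eventually_conj[OF eventually_ge_at_top[of 2] ev[of 0]]
      by (rule eventually_happens'[OF sequentially_bot])
  next
    fix t n
    show "\<exists>y. (2 \<le> y \<and> r y < \<epsilon> (Suc n)) \<and> t < y"
      using eventually_conj[OF eventually_conj[OF eventually_ge_at_top[of 2] ev[of "Suc n"]]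
          eventually_gt_at_top[of t]]
      by (rule eventually_happens'[OF sequentially_bot])
  qed
  then show ?thesis using that by (auto simp: strict_mono_Suc_iff)
qed

lemma kick_amplitudes:
  fixes T :: "nat \<Rightarrow> nat" and C :: real
  assumes T: "strict_mono T" "\<And>n. T n \<ge> 1" and C: "C \<ge> 0"
  obtains c :: "nat \<Rightarrow> real" where "\<And>t. c t \<ge> 0" "\<And>t. (\<Sum>s=1..t. c s) \<le> C"
    "\<And>n. c (T n - 1) = C / 2 ^ Suc n"
proof
  define c where "c t = (if Suc t \<in> range T then C / 2 ^ Suc (inv T (Suc t)) else 0)" for t
  have inj: "inj T" using T(1) by (rule strict_mono_imp_inj_on)
  show "c t \<ge> 0" for t using C by (simp add: c_def)
  show "c (T n - 1) = C / 2 ^ Suc n" for n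
    using T(2)[of n] inj by (simp add: c_def)
  have series: "(\<lambda>n. C * (1 / 2) ^ Suc n) sums C"
    using sums_mult[OF power_half_series, of C] by simp
  show "(\<Sum>s=1..t. c s) \<le> C" for t
  proof -
    let ?K = "{s \<in> {1..t}. Suc s \<in> range T}"
    let ?n = "\<lambda>s. inv T (Suc s)"
    have inj_n: "inj_on ?n ?K"
      by (auto intro!: inj_onI dest: inv_into_injective)
    have "(\<Sum>s=1..t. c s) = (\<Sum>s\<in>?K. C * (1 / 2) ^ Suc (?n s))"
      by (rule sum.mono_neutral_cong_right) (auto simp: c_def power_divide)
    also have "\<dots> = (\<Sum>n\<in>?n ` ?K. C * (1 / 2) ^ Suc n)"
      using inj_n by (simp add: sum.reindex)
    also have "\<dots> \<le> (\<Sum>n. C * (1 / 2) ^ Suc n)"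
      using C series by (intro sum_le_suminf) (auto simp: sums_iff)
    finally show ?thesis using series by (simp add: sums_iff)
  qed
qed

section \<open>Coin noise\<close>

lemma distr_PiM_fun_upd:
  assumes N: "\<And>j. prob_space (N j)" and h[measurable]: "h \<in> measurable (N i) (N i)"
    and inv: "distr (N i) (N i) h = N i"
  shows "distr (PiM UNIV N) (PiM UNIV N) (\<lambda>u. u(i := h (u i))) = PiM UNIV N"
proof -
  interpret product_prob_space N UNIV
    using N by (simp add: product_prob_spaceI)
  let ?M = "PiM UNIV N" and ?h = "\<lambda>u. u(i := h (u i))"
  have [measurable]: "?h \<in> measurable ?M ?M"
    by (rule measurable_fun_upd[where J = UNIV]) auto
  have "emeasure (distr ?M ?M ?h) (prod_emb UNIV N J (Pi\<^sub>E J F)) = (\<Prod>j\<in>J. emeasure (N j) (F j))"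
    if J: "finite J" and F: "\<And>j. j \<in> J \<Longrightarrow> F j \<in> sets (N j)" for J F
  proof -
    define F' where "F' j = (if j = i then h -` F j \<inter> space (N j) else F j)" for j
    have F': "F' j \<in> sets (N j)" if "j \<in> J" for j
      using F[OF that] h by (auto simp: F'_def)
    have eq: "emeasure (N j) (F' j) = emeasure (N j) (F j)" if "j \<in> J" for j
      using F[OF that] h arg_cong[OF inv, of "\<lambda>m. emeasure m (F j)"]
      by (auto simp: F'_def emeasure_distr)
    have h_space: "h w \<in> space (N i)" if "w \<in> space (N i)" for w
      using h that by (rule measurable_space)
    have "?h -` prod_emb UNIV N J (Pi\<^sub>E J F) \<inter> space ?M = prod_emb UNIV N J (Pi\<^sub>E J F')"
      using h_space
      by (auto simp: prod_emb_def space_PiM PiE_iff F'_def extensional_def split: if_splits)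
    then show ?thesis
      using J F F' eq
      by (simp add: emeasure_distr sets_PiM_I emeasure_PiM_emb cong: prod.cong)
  qed
  then show ?thesis
    by (intro PiM_eq) auto
qed

definition coin :: "real measure" where
  "coin = measure_pmf (pmf_of_set {-1, 1})"

text \<open>
  Both functions depend only on the sign of the coin, so that \<open>flip\<close> reverses the noise at every
  point of the sample space and not just almost surely.
\<close>

definition noise :: "(nat \<Rightarrow> real) \<Rightarrow> nat \<Rightarrow> real \<Rightarrow> real" where
  "noise c t w = (if 0 \<le> w then c t else - c t)"

definition flip :: "nat \<Rightarrow> (nat \<Rightarrow> real) \<Rightarrow> nat \<Rightarrow> real" where
  "flip t u = u(t := (if 0 \<le> u t then -1 else 1))"

definition coin_oracle :: "real \<Rightarrow> (nat \<Rightarrow> real) \<Rightarrow> real oracle_fun" where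
  "coin_oracle a c t = (\<lambda>(q, h, w). a * q t + noise c t w)"

lemma prob_space_coin: "prob_space coin"
  unfolding coin_def by (rule prob_space_measure_pmf)

lemma sets_coin: "sets coin = UNIV" and space_coin: "space coin = UNIV"
  by (simp_all add: coin_def)

lemma coin_flip: "distr coin coin (\<lambda>w. if 0 \<le> w then -1 else 1) = coin"
proof -
  let ?h = "\<lambda>w::real. if 0 \<le> w then -1 else 1 :: real"
  have "map_pmf ?h (pmf_of_set {-1, 1}) = pmf_of_set (?h ` {-1, 1})"
    by (rule map_pmf_of_set_inj) (auto simp: inj_on_def)
  also have "?h ` {-1, 1} = {-1, 1}" by auto
  finally have "measure_pmf (map_pmf ?h (pmf_of_set {-1, 1})) = coin"
    by (simp add: coin_def)
  moreover have "distr coin coin ?h = distr coin (count_space UNIV) ?h"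
    by (rule distr_cong) (auto simp: coin_def)
  ultimately show ?thesis by (simp add: coin_def map_pmf_rep_eq)
qed

lemma noise_measurable [measurable]: "noise c t \<in> borel_measurable coin"
  by (simp add: measurable_def sets_coin space_coin)

lemma abs_noise: "\<bar>noise c t w\<bar> = \<bar>c t\<bar>"
  by (simp add: noise_def)

lemma stochastic_coin_oracle: "stochastic_oracle (\<lambda>_. coin) (coin_oracle a c)"
  unfolding stochastic_oracle_def
proof (intro conjI allI impI)
  show "prob_space coin" by (rule prob_space_coin)
  fix t :: nat assume t: "t \<ge> 1"
  have [measurable]: "(\<lambda>q::nat \<Rightarrow> real. q t) \<in> borel_measurable (\<Pi>\<^sub>M s\<in>{1..t}. borel)"
    using t by (intro measurable_component_singleton) auto
  show "coin_oracle a c t \<in> borel_measurable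
      ((\<Pi>\<^sub>M s\<in>{1..t}. borel) \<Otimes>\<^sub>M (\<Pi>\<^sub>M s\<in>{1..<t}. borel) \<Otimes>\<^sub>M coin)"
    unfolding coin_oracle_def by measurable
qed

lemma adagrad_real: "adagrad \<eta> b0 = (adagrad_norm \<eta> b0 :: real update)"
  by (intro ext) (simp add: adagrad_def adagrad_norm_def Basis_real_def)

abbreviation coin_space :: "(nat \<Rightarrow> real) measure" where
  "coin_space \<equiv> \<Pi>\<^sub>M t\<in>UNIV. coin"

lemma prob_space_coin_space: "prob_space coin_space"
  by (rule prob_space_PiM) (rule prob_space_coin)

lemma space_coin_space: "space coin_space = UNIV"
  by (simp add: space_PiM space_coin)

lemma noise_component_measurable [measurable]:
  "(\<lambda>u. noise c t (u t)) \<in> borel_measurable coin_space"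
  by measurable

lemma distr_flip: "distr coin_space coin_space (flip t) = coin_space"
proof -
  have "distr coin_space coin_space (\<lambda>u. u(t := (\<lambda>w. if 0 \<le> w then -1 else 1) (u t))) = coin_space"
    using coin_flip by (intro distr_PiM_fun_upd prob_space_coin) (auto simp: measurable_def sets_coin space_coin)
  then show ?thesis by (simp add: flip_def[abs_def])
qed

lemma flip_measurable [measurable]: "flip t \<in> measurable coin_space coin_space"
proof -
  have "(\<lambda>u. u(t := (\<lambda>w. if 0 \<le> w then -1 else 1) (u t))) \<in> measurable coin_space coin_space"
    by (rule measurable_fun_upd[where J = UNIV])
       (auto intro!: measurable_compose[OF measurable_component_singleton]
         simp: measurable_def[of coin coin] sets_coin space_coin)
  then show ?thesis by (simp add: flip_def[abs_def])
qed

lemma integral_flip: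
  fixes F :: "(nat \<Rightarrow> real) \<Rightarrow> real"
  assumes "F \<in> borel_measurable coin_space"
  shows "(\<integral>u. F (flip t u) \<partial>coin_space) = (\<integral>u. F u \<partial>coin_space)"
  using integral_distr[OF flip_measurable assms, of t] distr_flip[of t] by simp

lemma noise_flip: "noise c t (flip t u t) = - noise c t (u t)"
  by (simp add: noise_def flip_def)

section \<open>The run of AdaGrad\<close>

locale coin_run =
  fixes a \<eta> b0 :: real and c :: "nat \<Rightarrow> real"
  assumes a_nonneg: "a \<ge> 0" and \<eta>_pos: "\<eta> > 0" and b0_pos: "b0 > 0" and step_le: "\<eta> * a \<le> b0"
    and c_nonneg: "\<And>t. c t \<ge> 0" and budget: "\<And>t. (\<Sum>s=1..t. c s) \<le> b0 / 4"
begin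

abbreviation "x \<equiv> iterate (adagrad_norm \<eta> b0) 0 (coin_oracle a c)"
abbreviation "g \<equiv> gradient (adagrad_norm \<eta> b0) 0 (coin_oracle a c)"
abbreviation "b t u \<equiv> sqrt (b0\<^sup>2 + (\<Sum>s=1..t. (g s u)\<^sup>2))"

lemma x_start: "t \<le> 1 \<Longrightarrow> x t u = 0"
  by (subst iterate.simps) simp

lemma x_Suc: "t \<ge> 1 \<Longrightarrow> x (Suc t) u = x t u - \<eta> / b t u * g t u"
  by (subst iterate.simps) (simp add: adagrad_norm_def)

lemma g_eq: "t \<ge> 1 \<Longrightarrow> g t u = a * x t u + noise c t (u t)"
  by (subst gradient.simps) (simp add: coin_oracle_def)

lemma x_bound: "\<bar>x (Suc t) u\<bar> \<le> \<eta> / b0 * (\<Sum>s=1..t. c s)"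
  and b_le: "b t u \<le> 2 * b0"
proof -
  have n: "\<bar>g t u - a * x t u\<bar> \<le> c t" if "t \<ge> 1" for t
    using that c_nonneg by (simp add: g_eq abs_noise)
  note run = adagrad_summable_noise[where x = "\<lambda>t. x t u" and g = "\<lambda>t. g t u" and c = c,
      OF a_nonneg \<eta>_pos b0_pos step_le x_start[OF order_refl] x_Suc n budget]
  show "\<bar>x (Suc t) u\<bar> \<le> \<eta> / b0 * (\<Sum>s=1..t. c s)" by (rule run(1))
  show "b t u \<le> 2 * b0" by (rule run(2))
qed

lemma b_ge: "b t u \<ge> b0"
  using b0_pos by (intro real_le_rsqrt) (simp add: sum_nonneg)

lemma x_bounded: "\<bar>x t u\<bar> \<le> \<eta>"
proof (cases t)
  case 0
  then show ?thesis using \<eta>_pos by (simp add: x_start)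
next
  case (Suc m)
  have "\<eta> / b0 * (\<Sum>s=1..m. c s) \<le> \<eta> / b0 * (b0 / 4)"
    using budget \<eta>_pos b0_pos by (intro mult_left_mono) auto
  also have "\<dots> \<le> \<eta>" using \<eta>_pos b0_pos by simp
  finally show ?thesis using x_bound[of m u] by (simp add: Suc)
qed

lemma x_cong: "(\<And>s. s < t \<Longrightarrow> u s = v s) \<Longrightarrow> x t u = x t v"
proof (induction t rule: less_induct)
  case (less t)
  show ?case
  proof (cases "t \<le> 1")
    case True
    then show ?thesis by (simp add: x_start)
  next
    case False
    then obtain m where m: "t = Suc m" "m \<ge> 1" by (cases t) auto
    have x: "x s u = x s v" if "s \<le> m" for s
      using less that m by auto
    have g: "g s u = g s v" if "s \<in> {1..m}" for s
      using that x[of s] less.prems m by (simp add: g_eq)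
    have "(\<Sum>s=1..m. (g s u)\<^sup>2) = (\<Sum>s=1..m. (g s v)\<^sup>2)"
      using g by (intro sum.cong) auto
    then show ?thesis using m x[of m] g[of m] by (simp add: x_Suc)
  qed
qed

lemma x_flip: "s \<le> t \<Longrightarrow> x s (flip t u) = x s u"
  by (rule x_cong) (simp add: flip_def)

lemma g_flip: "1 \<le> s \<Longrightarrow> s < t \<Longrightarrow> g s (flip t u) = g s u"
  by (simp add: g_eq x_flip) (simp add: flip_def)

text \<open>
  Stated for an arbitrary space \<open>F\<close>, to be used for the sample space as well as for the past.
\<close>

lemma x_measurable_from_gradients:
  assumes "\<And>s. 1 \<le> s \<Longrightarrow> s < t \<Longrightarrow> g s \<in> borel_measurable F"
  shows "x t \<in> borel_measurable F"
  using assms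
proof (induction t)
  case 0
  then show ?case by (simp add: x_start cong: measurable_cong)
next
  case (Suc m)
  show ?case
  proof (cases "m = 0")
    case True
    then show ?thesis by (simp add: x_start cong: measurable_cong)
  next
    case False
    have [measurable]: "x m \<in> borel_measurable F" using Suc by simp
    have g[measurable]: "g m \<in> borel_measurable F" using Suc.prems False by simp
    have [measurable]: "(\<lambda>u. \<Sum>s=1..m. (g s u)\<^sup>2) \<in> borel_measurable F"
      using Suc.prems by (intro borel_measurable_sum borel_measurable_power) auto
    have "(\<lambda>u. x m u - \<eta> / b m u * g m u) \<in> borel_measurable F" by measurable
    then show ?thesis using False by (simp add: x_Suc cong: measurable_cong)
  qed
qed

lemma g_measurable: "t \<ge> 1 \<Longrightarrow> g t \<in> borel_measurable coin_space"
proof (induction t rule: less_induct)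
  case (less t)
  have [measurable]: "x t \<in> borel_measurable coin_space"
    using less.IH by (intro x_measurable_from_gradients)
  have "(\<lambda>u. a * x t u + noise c t (u t)) \<in> borel_measurable coin_space" by measurable
  then show ?case using less.prems by (simp add: g_eq cong: measurable_cong)
qed

lemma x_measurable [measurable]: "x t \<in> borel_measurable coin_space"
  using g_measurable by (rule x_measurable_from_gradients)

lemma x_integrable: "integrable coin_space (x t)"
proof -
  interpret prob_space coin_space by (rule prob_space_coin_space)
  show ?thesis by (rule integrable_const_bound[of _ \<eta>]) (auto simp: x_bounded)
qed

lemma noise_integrable: "integrable coin_space (\<lambda>u. noise c t (u t))"
proof -
  interpret prob_space coin_space by (rule prob_space_coin_space)
  show ?thesis by (rule integrable_const_bound[of _ "\<bar>c t\<bar>"]) (auto simp: abs_noise)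
qed

lemma g_integrable:
  assumes "t \<ge> 1" shows "integrable coin_space (g t)"
proof -
  have "g t = (\<lambda>u. a * x t u + noise c t (u t))" using assms by (auto simp: g_eq)
  then show ?thesis using x_integrable noise_integrable by simp
qed

lemma sets_past:
  "sets (past coin_space g t) =
    sigma_sets UNIV {g s -` A \<inter> UNIV | s A. s \<in> {1..t} \<and> A \<in> sets borel}"
  by (simp add: past_def space_coin_space)

lemma past_subalgebra: "subalgebra coin_space (past coin_space g t)"
  unfolding subalgebra_def
proof
  show "space (past coin_space g t) = space coin_space"
    by (simp add: past_def space_measure_of_conv)
  have "{g s -` A \<inter> UNIV | s A. s \<in> {1..t} \<and> A \<in> sets borel} \<subseteq> sets coin_space"
    using measurable_sets[OF g_measurable] by (auto simp: space_coin_space)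
  then show "sets (past coin_space g t) \<subseteq> sets coin_space"
    unfolding sets_past using sets.sigma_sets_subset[of _ coin_space]
    by (simp add: space_coin_space)
qed

lemma g_past_measurable:
  assumes "1 \<le> s" "s \<le> t" shows "g s \<in> borel_measurable (past coin_space g t)"
proof (rule measurableI)
  fix A :: "real set" assume "A \<in> sets borel"
  then show "g s -` A \<inter> space (past coin_space g t) \<in> sets (past coin_space g t)"
    using assms unfolding sets_past
    by (intro sigma_sets.Basic) (auto simp: past_def space_measure_of_conv space_coin_space)
qed simp

lemma x_past_measurable: "x t \<in> borel_measurable (past coin_space g (t - 1))"
  by (intro x_measurable_from_gradients g_past_measurable) auto

text \<open>The answers before time \<open>t\<close> do not see the coin \<open>t\<close>, hence neither do the events of the past.\<close>

lemma past_flip: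
  assumes "A \<in> sets (past coin_space g (t - 1))"
  shows "flip t u \<in> A \<longleftrightarrow> u \<in> A"
  using assms unfolding sets_past
proof (induction A rule: sigma_sets.induct)
  case (Basic A)
  then show ?case by (force simp: g_flip)
qed auto

lemma noise_integral_past:
  assumes A: "A \<in> sets (past coin_space g (t - 1))"
  shows "(\<integral>u\<in>A. noise c t (u t) \<partial>coin_space) = 0"
proof -
  have [measurable]: "A \<in> sets coin_space"
    using A past_subalgebra by (auto simp: subalgebra_def)
  let ?F = "\<lambda>u. indicator A u *\<^sub>R noise c t (u t)"
  have "(\<integral>u. ?F u \<partial>coin_space) = (\<integral>u. ?F (flip t u) \<partial>coin_space)"
    by (rule integral_flip[symmetric]) measurable
  also have "\<dots> = (\<integral>u. - ?F u \<partial>coin_space)"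
    using past_flip[OF A] by (intro Bochner_Integration.integral_cong) (auto simp: noise_flip indicator_def)
  finally show ?thesis by (simp add: set_lebesgue_integral_def)
qed

lemma past_sigma_finite: "sigma_finite_subalgebra coin_space (past coin_space g t)"
proof -
  interpret prob_space coin_space by (rule prob_space_coin_space)
  show ?thesis
    by (intro finite_measure_subalgebra_is_sigma_finite finite_measure_subalgebra.intro
        finite_measure_subalgebra_axioms.intro past_subalgebra finite_measure_axioms)
qed

lemma gradient_unbiased:
  assumes t: "t \<ge> 1"
  shows "AE u in coin_space. real_cond_exp coin_space (past coin_space g (t - 1)) (g t) u = a * x t u"
proof -
  interpret sigma_finite_subalgebra coin_space "past coin_space g (t - 1)"
    by (rule past_sigma_finite)
  show ?thesis
  proof (rule real_cond_exp_charact)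
    fix A assume A: "A \<in> sets (past coin_space g (t - 1))"
    then have [measurable]: "A \<in> sets coin_space"
      using past_subalgebra by (auto simp: subalgebra_def)
    have "set_integrable coin_space A (\<lambda>u. a * x t u)"
      "set_integrable coin_space A (\<lambda>u. noise c t (u t))"
      unfolding set_integrable_def using x_integrable noise_integrable
      by (intro integrable_mult_indicator; simp)+
    then show "(\<integral>u\<in>A. g t u \<partial>coin_space) = (\<integral>u\<in>A. a * x t u \<partial>coin_space)"
      using t noise_integral_past[OF A] by (simp add: g_eq set_integral_add(2))
  next
    show "integrable coin_space (g t)" using t by (rule g_integrable)
    show "integrable coin_space (\<lambda>u. a * x t u)" using x_integrable by simp
    show "(\<lambda>u. a * x t u) \<in> borel_measurable (past coin_space g (t - 1))"
      using x_past_measurable by simp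
  qed
qed

lemma noise_subgaussian:
  assumes t: "t \<ge> 1" and c: "c t \<le> \<sigma>"
  shows "AE u in coin_space. nn_cond_exp coin_space (past coin_space g (t - 1))
      (\<lambda>u. ennreal (exp ((g t u - a * x t u)\<^sup>2 / \<sigma>\<^sup>2))) u \<le> ennreal (exp 1)"
proof -
  interpret sigma_finite_subalgebra coin_space "past coin_space g (t - 1)"
    by (rule past_sigma_finite)
  have [measurable]: "g t \<in> borel_measurable coin_space" using t by (rule g_measurable)
  have "(g t u - a * x t u)\<^sup>2 / \<sigma>\<^sup>2 \<le> 1" for u
  proof -
    have "(g t u - a * x t u)\<^sup>2 = (c t)\<^sup>2" using t by (simp add: g_eq noise_def)
    also have "\<dots> \<le> \<sigma>\<^sup>2" using c c_nonneg by (intro power_mono)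
    finally show ?thesis by (simp add: divide_le_eq_1)
  qed
  then have "AE u in coin_space. nn_cond_exp coin_space (past coin_space g (t - 1))
      (\<lambda>u. ennreal (exp ((g t u - a * x t u)\<^sup>2 / \<sigma>\<^sup>2))) u
      \<le> nn_cond_exp coin_space (past coin_space g (t - 1)) (\<lambda>u. ennreal (exp 1)) u"
    by (intro nn_cond_exp_mono) (auto intro!: ennreal_leI)
  moreover have "AE u in coin_space. ennreal (exp 1) =
      nn_cond_exp coin_space (past coin_space g (t - 1)) (\<lambda>u. ennreal (exp 1)) u"
    by (rule nn_cond_exp_F_meas) simp
  ultimately show ?thesis by eventually_elim simp
qed

lemma second_moment_after_kick:
  assumes t: "t \<ge> 1"
  shows "(\<integral>u. (x (Suc t) u)\<^sup>2 \<partial>coin_space) \<ge> (\<eta> * c t / (2 * b0))\<^sup>2 / 2"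
proof -
  interpret prob_space coin_space by (rule prob_space_coin_space)
  let ?k = "(\<eta> * c t / (2 * b0))\<^sup>2"
  let ?F = "\<lambda>u. (x (Suc t) u)\<^sup>2"
  have away: "?F u \<ge> ?k" if "noise c t (u t) * x t u \<le> 0" for u
  proof -
    let ?q = "\<eta> / b t u"
    have b: "b t u > 0" using b_ge[of u t] b0_pos by linarith
    have "\<eta> / (2 * b0) \<le> ?q"
      using b b_le[of u t] \<eta>_pos b0_pos by (intro divide_left_mono) auto
    then have "(\<eta> / (2 * b0) * c t)\<^sup>2 \<le> (?q * c t)\<^sup>2"
      using \<eta>_pos b0_pos c_nonneg by (intro power_mono mult_right_mono) auto
    also have "\<dots> = (?q * noise c t (u t))\<^sup>2"
      by (simp add: noise_def)
    also have "\<dots> \<le> (x t u - ?q * (a * x t u + noise c t (u t)))\<^sup>2"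
    proof (rule kick_away_from_minimizer)
      show "0 \<le> ?q" using b \<eta>_pos by simp
      show "?q * a \<le> 1" using b b_ge[of u t] step_le by simp
    qed (use that in simp)
    also have "\<dots> = ?F u" using t by (simp only: x_Suc g_eq)
    finally show ?thesis by simp
  qed
  \<comment> \<open>Of the two outcomes of the coin, at least one opposes the sign of \<open>x t u\<close>.\<close>
  have pair: "?k \<le> ?F u + ?F (flip t u)" for u
  proof (cases "noise c t (u t) * x t u \<le> 0")
    case True
    then show ?thesis using away[of u] by (intro add_increasing2) auto
  next
    case False
    then show ?thesis
      using away[of "flip t u"] by (intro add_increasing) (auto simp: noise_flip x_flip)
  qed
  have bound: "AE u in coin_space. norm (?F u) \<le> \<eta>\<^sup>2" "AE u in coin_space. norm (?F (flip t u)) \<le> \<eta>\<^sup>2"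
    using x_bounded \<eta>_pos by (auto intro!: AE_I2 simp: abs_le_square_iff[symmetric])
  have int: "integrable coin_space ?F" "integrable coin_space (\<lambda>u. ?F (flip t u))"
    by (rule integrable_const_bound[OF bound(1)], measurable)
       (rule integrable_const_bound[OF bound(2)], measurable)
  have "?k = (\<integral>u. ?k \<partial>coin_space)" by (simp add: prob_space)
  also have "\<dots> \<le> (\<integral>u. ?F u + ?F (flip t u) \<partial>coin_space)"
    using int pair by (intro integral_mono) auto
  also have "\<dots> = (\<integral>u. ?F u \<partial>coin_space) + (\<integral>u. ?F (flip t u) \<partial>coin_space)"
    using int by simp
  also have "(\<integral>u. ?F (flip t u) \<partial>coin_space) = (\<integral>u. ?F u \<partial>coin_space)"
    by (rule integral_flip) measurable
  finally show ?thesis by simp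
qed

end

section \<open>The slow instance\<close>

lemma deriv_half_square: "deriv (\<lambda>y. a / 2 * y\<^sup>2) = (\<lambda>y::real. a * y)"
proof
  fix y :: real
  have "((\<lambda>y. a / 2 * y\<^sup>2) has_field_derivative a * y) (at y)"
    by (auto intro!: derivative_eq_intros)
  then show "deriv (\<lambda>y. a / 2 * y\<^sup>2) y = a * y" by (rule DERIV_imp_deriv)
qed

theorem theorem3p1:
  fixes L \<sigma> b0 \<eta> D :: real and r :: "nat \<Rightarrow> real"
  assumes "L > 0" and "\<sigma> > 0" and "b0 > 0" and "\<eta> > 0" and "D > 0"
    and "\<forall>T\<ge>1. r T > 0" and "r \<longlonglongrightarrow> 0"
  shows "\<exists>(f :: real \<Rightarrow> real) (S :: nat \<Rightarrow> real measure) (G :: real oracle_fun) (T :: nat \<Rightarrow> nat).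
    quadratic f \<and> convex_on UNIV f \<and> L_smooth L f \<and> (\<forall>y. f 0 \<le> f y) \<and>
    stochastic_oracle S G \<and>
    (\<forall>n. T n \<ge> 1) \<and> filterlim T at_top sequentially \<and>
    (\<forall>U \<in> {adagrad_norm \<eta> b0, adagrad \<eta> b0}.
      let M = (\<Pi>\<^sub>M t\<in>UNIV. S t);
          x = iterate U 0 G;
          g = gradient U 0 G
      in (\<forall>t\<ge>1.
            integrable M (g t) \<and>
            (AE u in M. real_cond_exp M (past M g (t - 1)) (g t) u = deriv f (x t u)) \<and>
            (AE u in M. nn_cond_exp M (past M g (t - 1))
                (\<lambda>u. ennreal (exp ((g t u - deriv f (x t u))\<^sup>2 / \<sigma>\<^sup>2))) u \<le> ennreal (exp 1)) \<and>
            (AE u in M. \<bar>x t u - 0\<bar> \<le> D)) \<and>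
         filterlim (\<lambda>n. (\<integral>u. (f (x (T n) u) - f 0) \<partial>M) / r (T n)) at_top sequentially)"
proof -
  define a where "a = min L (b0 / \<eta>)"
  \<comment> \<open>The three bounds give sub-Gaussian noise, a bounded accumulator, and iterates in \<open>[- D, D]\<close>.\<close>
  define C where "C = min \<sigma> (min (b0 / 4) (D * b0 / \<eta>))"
  define f :: "real \<Rightarrow> real" where "f = (\<lambda>y. a / 2 * y\<^sup>2)"
  have a: "a > 0" "a \<le> L" "\<eta> * a \<le> b0"
    using assms by (auto simp: a_def min_def field_simps)
  have C: "C > 0" "C \<le> \<sigma>" "C \<le> b0 / 4" "C \<le> D * b0 / \<eta>"
    using assms unfolding C_def
    by (simp, intro min.cobounded1, intro min.coboundedI2 min.cobounded1,
        intro min.coboundedI2 min.cobounded2)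
  obtain T where T: "strict_mono T" "\<And>n. T n \<ge> 2" and rT: "\<And>n. r (T n) < 1 / 8 ^ n"
    using late_times[OF \<open>r \<longlonglongrightarrow> 0\<close>, of "\<lambda>n. 1 / 8 ^ n"] by auto
  have T1: "T n \<ge> 1" for n using T(2)[of n] by linarith
  obtain c where c: "\<And>t. c t \<ge> 0" "\<And>t. (\<Sum>s=1..t. c s) \<le> C" "\<And>n. c (T n - 1) = C / 2 ^ Suc n"
    using kick_amplitudes[OF T(1) T1, of C] C(1) by auto
  interpret coin_run a \<eta> b0 c
    using assms a c order_trans[OF c(2) C(3)] by unfold_locales auto
  have c_le: "c t \<le> \<sigma>" if "t \<ge> 1" for t
  proof -
    have "c t \<le> (\<Sum>s=1..t. c s)" using that c(1) by (intro member_le_sum) auto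
    then show ?thesis using c(2)[of t] C(2) by linarith
  qed
  have deriv_f: "deriv f y = a * y" for y
    unfolding f_def deriv_half_square ..
  have x_le: "\<bar>x t u\<bar> \<le> D" for t u
  proof (cases t)
    case 0
    then show ?thesis using assms by (simp add: x_start)
  next
    case (Suc m)
    have "\<bar>x t u\<bar> \<le> \<eta> / b0 * (\<Sum>s=1..m. c s)" using x_bound Suc by simp
    also have "\<dots> \<le> \<eta> / b0 * (D * b0 / \<eta>)"
      using c(2)[of m] C(4) assms by (intro mult_left_mono) auto
    also have "\<dots> = D" using assms by simp
    finally show ?thesis .
  qed
  define K where "K = a / 2 * ((\<eta> * C / (4 * b0))\<^sup>2 / 2)"
  have K: "K > 0" using a C assms by (simp add: K_def)
  have growth: "K * 2 ^ n \<le> (\<integral>u. f (x (T n) u) - f 0 \<partial>coin_space) / r (T n)" for n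
  proof -
    have Tn: "Suc (T n - 1) = T n" "T n - 1 \<ge> 1" using T(2)[of n] by auto
    have "\<eta> * c (T n - 1) / (2 * b0) = \<eta> * C / (4 * b0) / 2 ^ n"
      unfolding c(3) by simp
    moreover have "(2 ^ n)\<^sup>2 = (4 ^ n :: real)"
      by (simp add: power2_eq_square flip: power_mult_distrib)
    ultimately have "a / 2 * ((\<eta> * c (T n - 1) / (2 * b0))\<^sup>2 / 2) = K / 4 ^ n"
      by (simp only: K_def power_divide) simp
    then have "K / 4 ^ n \<le> a / 2 * (\<integral>u. (x (T n) u)\<^sup>2 \<partial>coin_space)"
      using mult_left_mono[OF second_moment_after_kick[OF Tn(2)], of "a / 2"] a Tn(1) by simp
    then have E: "K / 4 ^ n \<le> (\<integral>u. f (x (T n) u) - f 0 \<partial>coin_space)"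
      by (simp add: f_def)
    have r: "r (T n) > 0" using assms T1 by auto
    have "K * 2 ^ n * r (T n) \<le> K * 2 ^ n * (1 / 8 ^ n)"
      using rT[of n] K by (intro mult_left_mono) auto
    also have "\<dots> = K / 4 ^ n"
      by (simp add: field_simps power_mult_distrib[symmetric])
    also note E
    finally show ?thesis unfolding pos_le_divide_eq[OF r] .
  qed
  have linear: "K * real n \<le> (\<integral>u. f (x (T n) u) - f 0 \<partial>coin_space) / r (T n)" for n
  proof -
    have "real n \<le> 2 ^ n" using of_nat_less_two_power[of n, where 'a = real] by simp
    then show ?thesis using K growth[of n] mult_left_mono[of "real n" "2 ^ n" K] by linarith
  qed
  have "filterlim (\<lambda>n. K * real n) at_top sequentially"
    using K by (intro filterlim_tendsto_pos_mult_at_top[OF tendsto_const] filterlim_real_sequentially)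
  then have ratio: "filterlim (\<lambda>n. (\<integral>u. (f (x (T n) u) - f 0) \<partial>coin_space) / r (T n)) at_top sequentially"
    by (rule filterlim_at_top_mono) (simp add: linear)
  have "quadratic f"
    unfolding quadratic_def f_def
    using a by (intro exI[of _ "a / 2"] exI[of _ 0]) auto
  moreover have "convex_on UNIV f"
    unfolding f_def using a convex_power2 by (intro convex_on_cmul) auto
  moreover have "L_smooth L f"
    unfolding L_smooth_def
  proof (intro conjI allI)
    show "f differentiable at y" for y
      unfolding f_def by (intro derivative_intros)
    show "\<bar>deriv f y - deriv f z\<bar> \<le> L * \<bar>y - z\<bar>" for y z
      using a by (simp add: deriv_f right_diff_distrib[symmetric] abs_mult mult_right_mono)
  qed
  moreover have "\<forall>y. f 0 \<le> f y" using a by (simp add: f_def)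
  moreover have "filterlim T at_top sequentially"
    using T(1) by (rule filterlim_subseq)
  ultimately show ?thesis
    using T1 stochastic_coin_oracle[of a c] g_integrable gradient_unbiased noise_subgaussian c_le
      x_le ratio
    by (intro exI[of _ f] exI[of _ "\<lambda>_. coin"] exI[of _ "coin_oracle a c"] exI[of _ T])
       (simp add: adagrad_real deriv_f Let_def)
qed

end
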